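(* Let $n\ge 1$ and let $X=\sum_{1\le i<j\le n}\mathrm{wt}(i,j)\,I_{i,j}$ be a weighted inversion statistic on $S_n$ (with arbitrary fixed real weights $\mathrm{wt}(i,j)$). For a partition $\lambda=(1^{a_1},2^{a_2},\ldots,n^{a_n})\vdash n$, the expected value $\mathbb{E}_\lambda[X]$ of $X$ over the conjugacy class $C_\lambda$ depends only on $n$, $a_1$ and $a_2$; that is, if $\lambda,\mu\vdash n$ have the same number of parts equal to $1$ and the same number of parts equal to $2$, then $\mathbb{E}_\lambda[X]=\mathbb{E}_\mu[X]$.
   Context: $S_n$ is the symmetric group on $[n]=\{1,\dots,n\}$. For $\lambda\vdash n$, $C_\lambda$ is the conjugacy class of permutations of cycle type $\lambda$, and $\mathbb{E}_\lambda$ denotes expectation with respect to the uniform probability measure on $C_\lambda$. The notation $\lambda=(1^{a_1},2^{a_2},\ldots,n^{a_n})$ means $\lambda$ has exactly $a_i$ parts equal to $i$. For $1\le i<j\le n$, $I_{i,j}:S_n\to\{0,1\}$ is the indicator function of an inversion at $(i,j)$: $I_{i,j}(\omega)=1$ if $\omega(i)>\omega(j)$ and $0$ otherwise. A weighted inversion statistic on $S_n$ is any function of the form $\sum_{1\le i<j\le n}\mathrm{wt}(i,j)I_{i,j}$ with $\mathrm{wt}(i,j)\in\mathbb{R}$. *)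

theory Defs
  imports "HOL-Library.Multiset" "HOL-Combinatorics.Orbits" "HOL-Probability.Probability"
begin

text \<open>A partition of \<open>n\<close> is the multiset of its parts, so for
  \<open>lam = (1^{a_1}, 2^{a_2}, \<dots>)\<close> the multiplicity \<open>a_i\<close> is \<open>count lam i\<close>.\<close>

definition partition_of :: "nat \<Rightarrow> nat multiset \<Rightarrow> bool" where
  "partition_of n lam \<longleftrightarrow> 0 \<notin># lam \<and> sum_mset lam = n"

text \<open>For a permutation \<open>\<omega>\<close> of \<open>{1..n}\<close> the image \<open>orbit \<omega> ` {1..n}\<close> is the set of supports of the
  cycles of \<open>\<omega>\<close>, fixed points giving singletons; each support is counted once.\<close>

definition cycle_type :: "nat \<Rightarrow> (nat \<Rightarrow> nat) \<Rightarrow> nat multiset" where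
  "cycle_type n \<omega> = image_mset card (mset_set (orbit \<omega> ` {1..n}))"

definition conj_class :: "nat \<Rightarrow> nat multiset \<Rightarrow> (nat \<Rightarrow> nat) set" where
  "conj_class n lam = {\<omega>. \<omega> permutes {1..n} \<and> cycle_type n \<omega> = lam}"

definition class_expectation :: "nat \<Rightarrow> nat multiset \<Rightarrow> ((nat \<Rightarrow> nat) \<Rightarrow> real) \<Rightarrow> real" where
  "class_expectation n lam X = measure_pmf.expectation (pmf_of_set (conj_class n lam)) X"

definition inversion_ind :: "nat \<Rightarrow> nat \<Rightarrow> (nat \<Rightarrow> nat) \<Rightarrow> real" where
  "inversion_ind i j \<omega> = (if \<omega> i > \<omega> j then 1 else 0)"

definition weighted_inversion_stat :: "nat \<Rightarrow> (nat \<Rightarrow> nat \<Rightarrow> real) \<Rightarrow> (nat \<Rightarrow> nat) \<Rightarrow> real" where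
  "weighted_inversion_stat n wt \<omega> =
     (\<Sum>(i, j) \<in> {(i, j). 1 \<le> i \<and> i < j \<and> j \<le> n}. wt i j * inversion_ind i j \<omega>)"

end

theory Submission
  imports Defs
begin

text \<open>Averaging over the class equals averaging, for any single \<open>\<omega>\<close> in it, over all conjugates
  \<open>\<sigma> \<omega> \<sigma>\<^sup>-\<^sup>1\<close>. After the substitution \<open>i = \<sigma> p\<close>, \<open>j = \<sigma> q\<close> the latter is a sum over pairs
  \<open>p \<noteq> q\<close> of terms that depend only on which of the equalities \<open>\<omega> p = p\<close>, \<open>\<omega> q = q\<close>,
  \<open>\<omega> p = q\<close>, \<open>\<omega> q = p\<close> hold, and the number of pairs with a given pattern is determined by the
  numbers of fixed points and of 2-cycles of \<open>\<omega>\<close>.\<close>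

section \<open>Sums over the symmetric group and equality patterns of quadruples\<close>

text \<open>In the finite set \<open>S\<close>, \<open>A\<close> and its image have complements of
  equal size, and any bijection between these completes \<open>f\<close> to a permutation.\<close>

lemma inj_on_extends_to_permutation:
  assumes "finite S" "A \<subseteq> S" "f ` A \<subseteq> S" "inj_on f A"
  obtains \<tau> where "\<tau> permutes S" "\<And>x. x \<in> A \<Longrightarrow> \<tau> x = f x"
proof -
  have "card (S - A) = card (S - f ` A)"
    using assms by (simp add: card_Diff_subset finite_subset card_image)
  then obtain g where g: "bij_betw g (S - A) (S - f ` A)"
    using assms(1) by (meson finite_Diff finite_same_card_bij)
  define \<tau> where "\<tau> x = (if x \<in> A then f x else if x \<in> S then g x else x)" for x
  have "bij_betw \<tau> A (f ` A)"
    using inj_on_imp_bij_betw[OF assms(4)] by (rule bij_betw_cong[THEN iffD1, rotated]) (simp add: \<tau>_def)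
  moreover have "bij_betw \<tau> (S - A) (S - f ` A)"
    using g by (rule bij_betw_cong[THEN iffD1, rotated]) (simp add: \<tau>_def)
  ultimately have "bij_betw \<tau> (A \<union> (S - A)) (f ` A \<union> (S - f ` A))"
    by (rule bij_betw_combine) auto
  moreover have "A \<union> (S - A) = S" "f ` A \<union> (S - f ` A) = S"
    using assms by auto
  ultimately have "bij_betw \<tau> S S" by simp
  then have "\<tau> permutes S"
    using assms(2) by (intro bij_imp_permutes) (auto simp: \<tau>_def)
  then show thesis by (rule that) (simp add: \<tau>_def)
qed

text \<open>As \<open>p \<noteq> q\<close> and \<open>r \<noteq> s\<close>, the four compared
  equalities are the only ones possible within a quadruple. When they agree, the entrywise map is
  well defined and injective, hence extends to \<open>S\<close>.\<close>

lemma permutation_of_equality_pattern: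
  assumes "finite S" "{p, q, r, s} \<subseteq> S" "{p', q', r', s'} \<subseteq> S"
    and "p \<noteq> q" "r \<noteq> s" "p' \<noteq> q'" "r' \<noteq> s'"
    and "r = p \<longleftrightarrow> r' = p'" "s = q \<longleftrightarrow> s' = q'" "r = q \<longleftrightarrow> r' = q'" "s = p \<longleftrightarrow> s' = p'"
  obtains \<tau> where "\<tau> permutes S" "\<tau> p = p'" "\<tau> q = q'" "\<tau> r = r'" "\<tau> s = s'"
proof -
  \<comment> \<open>The order of the tests is harmless: where two entries coincide, so do their
    primed counterparts.\<close>
  define f where "f x = (if x = p then p' else if x = q then q' else if x = r then r' else s')" for x
  have f: "f p = p'" "f q = q'" "f r = r'" "f s = s'"
    using assms(4-) by (auto simp: f_def)
  have "inj_on f {p, q, r, s}"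
    using assms(4-) by (auto simp: inj_on_def f)
  moreover have "f ` {p, q, r, s} \<subseteq> S"
    using assms(3) f by auto
  ultimately obtain \<tau> where "\<tau> permutes S" "\<And>x. x \<in> {p, q, r, s} \<Longrightarrow> \<tau> x = f x"
    using inj_on_extends_to_permutation[OF assms(1,2)] by blast
  then show thesis using that f by simp
qed

text \<open>An unnormalised average over the diagonal action of the symmetric group on quadruples,
  hence constant on its orbits.\<close>

definition symmetrized :: "'a set \<Rightarrow> ('a \<Rightarrow> 'a \<Rightarrow> 'a \<Rightarrow> 'a \<Rightarrow> real) \<Rightarrow> 'a \<Rightarrow> 'a \<Rightarrow> 'a \<Rightarrow> 'a \<Rightarrow> real" where
  "symmetrized S h p q r s = (\<Sum>\<sigma> | \<sigma> permutes S. h (\<sigma> p) (\<sigma> q) (\<sigma> r) (\<sigma> s))"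

lemma symmetrized_permute:
  assumes "\<tau> permutes S"
  shows "symmetrized S h (\<tau> p) (\<tau> q) (\<tau> r) (\<tau> s) = symmetrized S h p q r s"
  unfolding symmetrized_def
  by (subst sum_permutations_compose_right[OF assms]) (simp add: o_def)

text \<open>Quadruples with the same equalities lie in one orbit of the diagonal action;
  \<open>G\<close> reads the common value off a chosen representative.\<close>

lemma symmetrized_depends_on_equality_pattern:
  assumes "finite S"
  obtains G where "\<And>p q r s. {p, q, r, s} \<subseteq> S \<Longrightarrow> p \<noteq> q \<Longrightarrow> r \<noteq> s \<Longrightarrow>
    symmetrized S h p q r s = G (r = p) (s = q) (r = q) (s = p)"
proof -
  \<comment> \<open>A pattern need not be realised in a small \<open>S\<close>; then \<open>SOME\<close> yields a junk value that is never used.\<close>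
  define P where "P b1 b2 b3 b4 = (\<lambda>(p, q, r, s). {p, q, r, s} \<subseteq> S \<and> p \<noteq> q \<and> r \<noteq> s \<and>
    (r = p) = b1 \<and> (s = q) = b2 \<and> (r = q) = b3 \<and> (s = p) = b4)" for b1 b2 b3 b4
  define G where "G b1 b2 b3 b4 = (case (SOME t. P b1 b2 b3 b4 t) of (p, q, r, s) \<Rightarrow> symmetrized S h p q r s)"
    for b1 b2 b3 b4
  show thesis
  proof (rule that)
    fix p q r s assume *: "{p, q, r, s} \<subseteq> S" "p \<noteq> q" "r \<noteq> s"
    let ?P = "P (r = p) (s = q) (r = q) (s = p)"
    obtain p' q' r' s' where t: "(SOME t. ?P t) = (p', q', r', s')"
      by (metis prod.exhaust)
    have "?P (p, q, r, s)" using * by (simp add: P_def)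
    then have "?P (p', q', r', s')" using t by (metis someI)
    then have "{p', q', r', s'} \<subseteq> S" "p' \<noteq> q'" "r' \<noteq> s'"
      "r = p \<longleftrightarrow> r' = p'" "s = q \<longleftrightarrow> s' = q'" "r = q \<longleftrightarrow> r' = q'" "s = p \<longleftrightarrow> s' = p'"
      by (auto simp: P_def)
    from permutation_of_equality_pattern[OF assms *(1) this(1) *(2,3) this(2-)]
    obtain \<tau> where "\<tau> permutes S" "\<tau> p = p'" "\<tau> q = q'" "\<tau> r = r'" "\<tau> s = s'"
      by metis
    then have "symmetrized S h p q r s = symmetrized S h p' q' r' s'"
      using symmetrized_permute by metis
    then show "symmetrized S h p q r s = G (r = p) (s = q) (r = q) (s = p)"
      by (simp add: G_def t)
  qed
qed

text \<open>Distinctness leaves seven patterns: no equality, one of four single ones, or one of two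
  compatible pairs. Seven coefficients fit all values, and the linear form reduces later sums to
  counting pairs.\<close>

lemma symmetrized_indicator_expansion:
  assumes "finite S"
  obtains c0 c1 c2 c3 c4 c5 c6 :: real where
    "\<And>p q r s. {p, q, r, s} \<subseteq> S \<Longrightarrow> p \<noteq> q \<Longrightarrow> r \<noteq> s \<Longrightarrow>
      symmetrized S h p q r s = c0 + c1 * of_bool (r = p) + c2 * of_bool (s = q)
        + c3 * of_bool (r = q) + c4 * of_bool (s = p)
        + c5 * of_bool (r = p \<and> s = q) + c6 * of_bool (r = q \<and> s = p)"
proof -
  from symmetrized_depends_on_equality_pattern[OF assms, of h] obtain G where
    G: "\<And>p q r s. {p, q, r, s} \<subseteq> S \<Longrightarrow> p \<noteq> q \<Longrightarrow> r \<noteq> s \<Longrightarrow>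
      symmetrized S h p q r s = G (r = p) (s = q) (r = q) (s = p)" by blast
  \<comment> \<open>Inclusion-exclusion: each coefficient is the value at its own pattern minus all
    other terms active there.\<close>
  define c0 where "c0 = G False False False False"
  define c1 where "c1 = G True False False False - c0"
  define c2 where "c2 = G False True False False - c0"
  define c3 where "c3 = G False False True False - c0"
  define c4 where "c4 = G False False False True - c0"
  define c5 where "c5 = G True True False False - c0 - c1 - c2"
  define c6 where "c6 = G False False True True - c0 - c3 - c4"
  note c = c6_def c5_def c4_def c3_def c2_def c1_def c0_def
  show thesis
  proof (rule that)
    fix p q r s assume *: "{p, q, r, s} \<subseteq> S" "p \<noteq> q" "r \<noteq> s"
    show "symmetrized S h p q r s = c0 + c1 * of_bool (r = p) + c2 * of_bool (s = q)
        + c3 * of_bool (r = q) + c4 * of_bool (s = p)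
        + c5 * of_bool (r = p \<and> s = q) + c6 * of_bool (r = q \<and> s = p)"
      unfolding G[OF *] using *(2,3)
      by (cases "r = p"; cases "s = q"; cases "r = q"; cases "s = p") (simp_all add: c)
  qed
qed

section \<open>Counting ordered pairs of distinct points\<close>

text \<open>Over the full square the variables range independently, which makes indicator sums easy;
  the condition \<open>p \<noteq> q\<close> then costs only the diagonal.\<close>

lemma sum_off_diagonal:
  fixes f :: "'a \<Rightarrow> 'a \<Rightarrow> real"
  assumes "finite S"
  shows "(\<Sum>(p, q) \<in> Sigma S (\<lambda>p. S - {p}). f p q) = (\<Sum>p\<in>S. \<Sum>q\<in>S. f p q) - (\<Sum>p\<in>S. f p p)"
proof -
  have "(\<Sum>(p, q) \<in> Sigma S (\<lambda>p. S - {p}). f p q) = (\<Sum>p\<in>S. \<Sum>q\<in>S - {p}. f p q)"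
    using assms by (subst sum.Sigma) auto
  also have "\<dots> = (\<Sum>p\<in>S. (\<Sum>q\<in>S. f p q) - f p p)"
    using assms by (intro sum.cong) (simp_all add: sum_diff1)
  finally show ?thesis by (simp add: sum_subtractf)
qed

text \<open>\<open>K\<close> is fixed before \<open>\<omega>\<close>, so one function serves all
  permutations of \<open>S\<close>. Its second argument counts points on 2-cycles, twice the number
  of 2-cycles.\<close>

lemma sum_symmetrized_fixpoints_2cycles:
  assumes "finite S"
  obtains K :: "nat \<Rightarrow> nat \<Rightarrow> real" where
    "\<And>\<omega>. \<omega> permutes S \<Longrightarrow>
      (\<Sum>(p, q) \<in> Sigma S (\<lambda>p. S - {p}). symmetrized S h p q (\<omega> p) (\<omega> q)) =
      K (card {p \<in> S. \<omega> p = p}) (card {p \<in> S. \<omega> p \<noteq> p \<and> \<omega> (\<omega> p) = p})"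
proof -
  from symmetrized_indicator_expansion[OF assms, of h] obtain c0 c1 c2 c3 c4 c5 c6 :: real where c:
    "\<And>p q r s. {p, q, r, s} \<subseteq> S \<Longrightarrow> p \<noteq> q \<Longrightarrow> r \<noteq> s \<Longrightarrow>
      symmetrized S h p q r s = c0 + c1 * of_bool (r = p) + c2 * of_bool (s = q)
        + c3 * of_bool (r = q) + c4 * of_bool (s = p)
        + c5 * of_bool (r = p \<and> s = q) + c6 * of_bool (r = q \<and> s = p)"
    by blast
  define N where "N = real (card S)"
  \<comment> \<open>Pairs per indicator: \<open>N(N-1)\<close> in all; \<open>a(N-1)\<close> with
    \<open>p\<close> fixed, and as many with \<open>q\<close> fixed; \<open>N-a\<close> with
    \<open>\<omega> p = q\<close>, since \<open>p\<close> must move and determines \<open>q\<close>,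
    and likewise for \<open>\<omega> q = p\<close>; \<open>a(a-1)\<close> with both fixed;
    \<open>b\<close> with \<open>p\<close> and \<open>q\<close> exchanged.\<close>
  define K where "K a b = c0 * (N * N - N) + (c1 + c2) * (N * real a - real a)
     + (c3 + c4) * (N - real a) + c5 * (real a * real a - real a) + c6 * real b" for a b :: nat
  show thesis
  proof (rule that)
    fix \<omega> assume \<omega>: "\<omega> permutes S"
    define a where "a = card {p \<in> S. \<omega> p = p}"
    define b where "b = card {p \<in> S. \<omega> p \<noteq> p \<and> \<omega> (\<omega> p) = p}"
    let ?D = "Sigma S (\<lambda>p. S - {p})"
    have in_S: "\<omega> p \<in> S" if "p \<in> S" for p
      using \<omega> that by (simp add: permutes_in_image)
    have fix_sum: "(\<Sum>p\<in>S. of_bool (\<omega> p = p)) = real a"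
      using assms by (simp add: a_def sum.If_cases of_bool_def Int_def)
    have one: "(\<Sum>q\<in>S. of_bool (\<omega> p = q)) = (1::real)" if "p \<in> S" for p
      using assms in_S[OF that] by (simp add: of_bool_def)
    have two: "(\<Sum>q\<in>S. of_bool (\<omega> p = q \<and> \<omega> q = p)) = (of_bool (\<omega> (\<omega> p) = p) :: real)" if "p \<in> S" for p
    proof -
      have "(\<Sum>q\<in>S. of_bool (\<omega> p = q \<and> \<omega> q = p)) = (\<Sum>q\<in>S. if \<omega> p = q then of_bool (\<omega> (\<omega> p) = p) else (0::real))"
        by (intro sum.cong) auto
      then show ?thesis using assms in_S[OF that] by simp
    qed
    have D0: "(\<Sum>(p, q) \<in> ?D. 1) = N * N - N"
      by (simp only: sum_off_diagonal[OF assms] N_def) simp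
    have D1: "(\<Sum>(p, q) \<in> ?D. of_bool (\<omega> p = p)) = N * real a - real a"
      by (simp add: sum_off_diagonal[OF assms] fix_sum N_def flip: sum_distrib_left)
    have D2: "(\<Sum>(p, q) \<in> ?D. of_bool (\<omega> q = q)) = N * real a - real a"
      by (simp add: sum_off_diagonal[OF assms] fix_sum N_def)
    have D3: "(\<Sum>(p, q) \<in> ?D. of_bool (\<omega> p = q)) = N - real a"
      by (simp add: sum_off_diagonal[OF assms] fix_sum one N_def)
    \<comment> \<open>Here \<open>q\<close> determines \<open>p\<close>, so the sums are swapped
      before \<open>one\<close> applies.\<close>
    have D4: "(\<Sum>(p, q) \<in> ?D. of_bool (\<omega> q = p)) = N - real a"
      by (simp add: sum_off_diagonal[OF assms] fix_sum) (subst sum.swap, simp add: one N_def)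
    \<comment> \<open>The conjunction is split into a product so that the double sum factors as
      \<open>a * a\<close>; on the diagonal the product is merged again.\<close>
    have D5: "(\<Sum>(p, q) \<in> ?D. of_bool (\<omega> p = p \<and> \<omega> q = q)) = real a * real a - real a"
      by (simp add: sum_off_diagonal[OF assms] fix_sum of_bool_conj flip: sum_distrib_left sum_distrib_right)
         (simp add: fix_sum flip: of_bool_conj)
    \<comment> \<open>For each \<open>p\<close> the only candidate is \<open>q = \<omega> p\<close>.
      Subtracting the diagonal removes the fixed points and leaves the points on 2-cycles.\<close>
    have "(\<Sum>(p, q) \<in> ?D. of_bool (\<omega> p = q \<and> \<omega> q = p)) =
        (\<Sum>p\<in>S. of_bool (\<omega> (\<omega> p) = p) - of_bool (\<omega> p = p) :: real)"
      by (simp add: sum_off_diagonal[OF assms] two sum_subtractf)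
    also have "\<dots> = (\<Sum>p\<in>S. of_bool (\<omega> p \<noteq> p \<and> \<omega> (\<omega> p) = p))"
      by (intro sum.cong) auto
    also have "\<dots> = real b"
      using assms by (simp add: b_def sum.If_cases of_bool_def Int_def)
    finally have D6: "(\<Sum>(p, q) \<in> ?D. of_bool (\<omega> p = q \<and> \<omega> q = p)) = real b" .
    have "(\<Sum>(p, q) \<in> ?D. symmetrized S h p q (\<omega> p) (\<omega> q)) =
      (\<Sum>(p, q) \<in> ?D. c0 * 1 + c1 * of_bool (\<omega> p = p) + c2 * of_bool (\<omega> q = q)
        + c3 * of_bool (\<omega> p = q) + c4 * of_bool (\<omega> q = p)
        + c5 * of_bool (\<omega> p = p \<and> \<omega> q = q) + c6 * of_bool (\<omega> p = q \<and> \<omega> q = p))"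
    proof (intro sum.cong refl, unfold mem_Sigma_iff split_paired_all prod.case)
      fix p q assume "p \<in> S \<and> q \<in> S - {p}"
      then have pq: "p \<in> S" "q \<in> S" "p \<noteq> q" by auto
      then have "\<omega> p \<noteq> \<omega> q" using permutes_inj[OF \<omega>] by (auto dest: injD)
      then show "symmetrized S h p q (\<omega> p) (\<omega> q) =
         c0 * 1 + c1 * of_bool (\<omega> p = p) + c2 * of_bool (\<omega> q = q)
        + c3 * of_bool (\<omega> p = q) + c4 * of_bool (\<omega> q = p)
        + c5 * of_bool (\<omega> p = p \<and> \<omega> q = q) + c6 * of_bool (\<omega> p = q \<and> \<omega> q = p)"
        using pq in_S by (subst c) auto
    qed
    also have "\<dots> = c0 * (\<Sum>(p, q) \<in> ?D. 1) + c1 * (\<Sum>(p, q) \<in> ?D. of_bool (\<omega> p = p))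
        + c2 * (\<Sum>(p, q) \<in> ?D. of_bool (\<omega> q = q)) + c3 * (\<Sum>(p, q) \<in> ?D. of_bool (\<omega> p = q))
        + c4 * (\<Sum>(p, q) \<in> ?D. of_bool (\<omega> q = p))
        + c5 * (\<Sum>(p, q) \<in> ?D. of_bool (\<omega> p = p \<and> \<omega> q = q))
        + c6 * (\<Sum>(p, q) \<in> ?D. of_bool (\<omega> p = q \<and> \<omega> q = p))"
      by (simp only: case_prod_unfold sum.distrib sum_distrib_left)
    also have "\<dots> = K a b"
      unfolding D0 D1 D2 D3 D4 D5 D6 K_def by (simp add: algebra_simps)
    finally show "(\<Sum>(p, q) \<in> ?D. symmetrized S h p q (\<omega> p) (\<omega> q)) = K a b" .
  qed
qed

text \<open>Applying \<open>\<sigma>\<close> to both coordinates permutes the off-diagonal pairs,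
  and the conjugate sends \<open>\<sigma> p\<close> to \<open>\<sigma> (\<omega> p)\<close>.
  Exchanging the sums then produces \<open>symmetrized\<close>.\<close>

lemma sum_conjugates_eq_sum_symmetrized:
  assumes "finite S"
  shows "(\<Sum>\<sigma> | \<sigma> permutes S. \<Sum>(i, j) \<in> Sigma S (\<lambda>p. S - {p}).
            h i j ((\<sigma> \<circ> \<omega> \<circ> inv \<sigma>) i) ((\<sigma> \<circ> \<omega> \<circ> inv \<sigma>) j)) =
         (\<Sum>(p, q) \<in> Sigma S (\<lambda>p. S - {p}). symmetrized S h p q (\<omega> p) (\<omega> q))"
proof -
  let ?D = "Sigma S (\<lambda>p. S - {p})"
  have "(\<Sum>(i, j) \<in> ?D. h i j ((\<sigma> \<circ> \<omega> \<circ> inv \<sigma>) i) ((\<sigma> \<circ> \<omega> \<circ> inv \<sigma>) j)) =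
      (\<Sum>(p, q) \<in> ?D. h (\<sigma> p) (\<sigma> q) (\<sigma> (\<omega> p)) (\<sigma> (\<omega> q)))" if \<sigma>: "\<sigma> permutes S" for \<sigma>
    using permutes_inverses[OF \<sigma>] permutes_in_image[OF \<sigma>] permutes_in_image[OF permutes_inv[OF \<sigma>]]
      permutes_inj[OF \<sigma>] permutes_inj[OF permutes_inv[OF \<sigma>]]
    by (intro sum.reindex_bij_witness[where i = "map_prod \<sigma> \<sigma>" and j = "map_prod (inv \<sigma>) (inv \<sigma>)"])
       (auto dest: injD)
  then show ?thesis
    unfolding symmetrized_def by (simp add: case_prod_unfold) (rule sum.swap)
qed

section \<open>Orbits and cycle type\<close>

text \<open>\<open>orbit f x\<close> is generated from \<open>f x\<close>, not from
  \<open>x\<close>; finiteness of \<open>S\<close> makes some positive iterate return to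
  \<open>x\<close>.\<close>

lemma orbit_permutes_self:
  assumes "f permutes S" "finite S"
  shows "x \<in> orbit f x"
  using assms by (intro permutation_self_in_orbit) (auto simp: permutation_permutes)

lemma card_orbit_eq_2_iff:
  assumes "f permutes S" "finite S"
  shows "card (orbit f x) = 2 \<longleftrightarrow> f x \<noteq> x \<and> f (f x) = x"
proof
  note self = orbit_permutes_self[OF assms]
  assume "f x \<noteq> x \<and> f (f x) = x"
  moreover have "y \<in> {x, f x}" if "y \<in> orbit f x" for y
    using that calculation by (induction rule: orbit.induct) auto
  then have "orbit f x = {x, f x}"
    using self by (auto simp: orbit.base)
  ultimately show "card (orbit f x) = 2" by (simp add: card_2_iff) metis
next
  note self = orbit_permutes_self[OF assms]
  assume c: "card (orbit f x) = 2"
  then have ne: "f x \<noteq> x"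
    by (metis orbit_eq_singleton_iff card_1_singleton_iff One_nat_def n_not_Suc_n numeral_2_eq_2)
  \<comment> \<open>Two distinct points exhaust an orbit of size 2, so \<open>f (f x)\<close> is
    \<open>x\<close> or \<open>f x\<close>; injectivity excludes the latter.\<close>
  have "{x, f x} = orbit f x"
    using c ne self by (intro card_subset_eq finite_orbit) (auto simp: orbit.base)
  moreover have "f (f x) \<in> orbit f x" by (simp add: orbit.intros)
  moreover have "f (f x) \<noteq> f x" using ne permutes_inj[OF assms(1)] by (auto dest: injD)
  ultimately show "f x \<noteq> x \<and> f (f x) = x" using ne by auto
qed

lemma card_orbit_eq_1_iff:
  assumes "f permutes S" "finite S"
  shows "card (orbit f x) = 1 \<longleftrightarrow> f x = x"
  using orbit_permutes_self[OF assms, of x] orbit_eq_singleton_iff[of f x]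
  by (auto simp: card_1_singleton_iff)

text \<open>Distinct orbits are disjoint, so these points split into blocks of size
  \<open>k\<close>, one for each part equal to \<open>k\<close>. The cases \<open>k = 1\<close> and
  \<open>k = 2\<close> translate the arguments of \<open>K\<close> into multiplicities of
  parts.\<close>

lemma card_points_in_orbits_of_size:
  assumes "\<omega> permutes {1..n}"
  shows "card {p \<in> {1..n}. card (orbit \<omega> p) = k} = k * count (cycle_type n \<omega>) k"
proof -
  let ?S = "{1..n}"
  let ?O = "{A \<in> orbit \<omega> ` ?S. card A = k}"
  have cyc: "cyclic_on \<omega> (orbit \<omega> x)" for x
    using assms by (intro cyclic_on_orbit) auto
  have eq: "orbit \<omega> x = orbit \<omega> y" if "x \<in> orbit \<omega> y" for x y
    using cyc that by (rule orbit_cyclic_eq3)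
  have "{p \<in> ?S. card (orbit \<omega> p) = k} = \<Union> ?O"
  proof
    show "{p \<in> ?S. card (orbit \<omega> p) = k} \<subseteq> \<Union> ?O"
      using orbit_permutes_self[OF assms] by fast
    show "\<Union> ?O \<subseteq> {p \<in> ?S. card (orbit \<omega> p) = k}"
    proof
      fix x assume "x \<in> \<Union> ?O"
      then obtain y where y: "y \<in> ?S" "x \<in> orbit \<omega> y" "card (orbit \<omega> y) = k" by blast
      then have "x \<in> ?S" using permutes_orbit_subset[OF assms] by blast
      then show "x \<in> {p \<in> ?S. card (orbit \<omega> p) = k}" using y eq[OF y(2)] by simp
    qed
  qed
  also have "card \<dots> = sum card ?O"
  proof (rule card_Union_disjoint)
    show "pairwise disjnt ?O"
    proof (rule pairwiseI)
      fix A B assume "A \<in> ?O" "B \<in> ?O" "A \<noteq> B"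
      then obtain x y where "A = orbit \<omega> x" "B = orbit \<omega> y" by blast
      with \<open>A \<noteq> B\<close> show "disjnt A B" unfolding disjnt_def by (metis disjoint_iff eq)
    qed
    show "finite A" if "A \<in> ?O" for A
      using that finite_cyclic_on[OF cyc] by blast
  qed
  also have "\<dots> = k * card ?O" by simp
  also have "card ?O = count (cycle_type n \<omega>) k"
  proof -
    have "count (cycle_type n \<omega>) k = (\<Sum>A\<in>?O. count (mset_set (orbit \<omega> ` ?S)) A)"
      unfolding cycle_type_def count_image_mset by (intro sum.cong) auto
    also have "\<dots> = (\<Sum>A\<in>?O. 1)"
      by (intro sum.cong refl count_mset_set(1)) auto
    finally show ?thesis by simp
  qed
  finally show ?thesis .
qed

section \<open>Invariance under conjugation\<close>

text \<open>\<open>\<sigma>\<close> carries each orbit of \<open>\<omega>\<close> bijectively onto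
  an orbit of the conjugate, so orbit sizes are preserved.\<close>

lemma cycle_type_conjugate:
  assumes \<sigma>: "\<sigma> permutes {1..n}" and \<omega>: "\<omega> permutes {1..n}"
  shows "cycle_type n (\<sigma> \<circ> \<omega> \<circ> inv \<sigma>) = cycle_type n \<omega>"
proof -
  have inj: "inj \<sigma>" using \<sigma> by (rule permutes_inj)
  have orb: "orbit (\<sigma> \<circ> \<omega> \<circ> inv \<sigma>) (\<sigma> x) = \<sigma> ` orbit \<omega> x" for x
    using orbit_permutes_self[OF \<omega>] permutes_inverses[OF \<sigma>]
    by (intro orbit_inverse[symmetric]) auto
  have "orbit (\<sigma> \<circ> \<omega> \<circ> inv \<sigma>) ` {1..n} = orbit (\<sigma> \<circ> \<omega> \<circ> inv \<sigma>) ` \<sigma> ` {1..n}"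
    using \<sigma> by (simp add: permutes_image)
  also have "\<dots> = image \<sigma> ` orbit \<omega> ` {1..n}"
    unfolding image_image orb ..
  finally have "mset_set (orbit (\<sigma> \<circ> \<omega> \<circ> inv \<sigma>) ` {1..n}) = image_mset (image \<sigma>) (mset_set (orbit \<omega> ` {1..n}))"
    using inj by (simp add: image_mset_mset_set inj_on_def inj_image_eq_iff)
  then show ?thesis
    using inj by (simp add: cycle_type_def multiset.map_comp o_def card_image inj_on_subset)
qed

lemma sum_conj_class_conjugate:
  assumes \<sigma>: "\<sigma> permutes {1..n}"
  shows "(\<Sum>\<omega>\<in>conj_class n lam. X (\<sigma> \<circ> \<omega> \<circ> inv \<sigma>)) = (\<Sum>\<omega>\<in>conj_class n lam. X \<omega>)"
proof -
  have cancel: "inv \<sigma> \<circ> (\<sigma> \<circ> \<omega> \<circ> inv \<sigma>) \<circ> \<sigma> = \<omega>" "\<sigma> \<circ> (inv \<sigma> \<circ> \<omega> \<circ> \<sigma>) \<circ> inv \<sigma> = \<omega>" for \<omega>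
    using permutes_inverses[OF \<sigma>] by (auto simp: fun_eq_iff)
  \<comment> \<open>Closure of the class is applied to both \<open>\<sigma>\<close> and
    \<open>inv \<sigma>\<close>; this equation puts the second instance into the form of the inverse
    bijection.\<close>
  have "inv (inv \<sigma>) = \<sigma>" using \<sigma> by (rule permutes_inv_inv)
  moreover have "\<tau> \<circ> \<omega> \<circ> inv \<tau> \<in> conj_class n lam"
    if "\<tau> permutes {1..n}" "\<omega> \<in> conj_class n lam" for \<tau> \<omega>
    using that cycle_type_conjugate[of \<tau> n \<omega>]
    by (auto simp: conj_class_def intro!: permutes_compose permutes_inv)
  ultimately have "inv \<sigma> \<circ> \<omega> \<circ> \<sigma> \<in> conj_class n lam" "\<sigma> \<circ> \<omega> \<circ> inv \<sigma> \<in> conj_class n lam"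
    if "\<omega> \<in> conj_class n lam" for \<omega>
    using that \<sigma> permutes_inv[OF \<sigma>] by metis+
  then show ?thesis
    using cancel
    by (intro sum.reindex_bij_witness[where i = "\<lambda>\<omega>. inv \<sigma> \<circ> \<omega> \<circ> \<sigma>" and j = "\<lambda>\<omega>. \<sigma> \<circ> \<omega> \<circ> inv \<sigma>"])
       simp_all
qed

section \<open>Existence of permutations of a given cycle type\<close>

lemma cycle_type_append_cycle:
  assumes \<omega>: "\<omega> permutes {1..m}" and k: "k > 0"
  obtains \<omega>' where "\<omega>' permutes {1..m + k}" "cycle_type (m + k) \<omega>' = add_mset k (cycle_type m \<omega>)"
proof -
  \<comment> \<open>The points above \<open>m\<close> form one new cycle. For \<open>k = 1\<close>
    the first branch is empty and \<open>m + 1\<close> is fixed; points outside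
    \<open>{1..m + k}\<close> are fixed because \<open>\<omega>\<close> fixes them.\<close>
  define c where "c x = (if m < x \<and> x < m + k then x + 1 else if x = m + k then m + 1 else \<omega> x)" for x
  have id: "\<omega> x = x" if "x > m" for x
    using \<omega> that by (simp add: permutes_not_in)
  have le: "1 \<le> \<omega> x \<and> \<omega> x \<le> m" if "1 \<le> x" "x \<le> m" for x
    using permutes_in_image[OF \<omega>, of x] that by simp
  have inj: "inj_on c {1..m + k}"
  proof (rule inj_onI)
    fix x y assume "x \<in> {1..m + k}" "y \<in> {1..m + k}" "c x = c y"
    show "x = y"
    proof (cases "x \<le> m"; cases "y \<le> m")
      assume "x \<le> m" "y \<le> m"
      then have "\<omega> x = \<omega> y" using \<open>c x = c y\<close> k by (simp add: c_def)
      then show ?thesis using permutes_inj[OF \<omega>] by (simp add: inj_eq)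
    next
      assume "x \<le> m" "\<not> y \<le> m"
      then have "c x \<le> m" "c y > m"
        using le[of x] \<open>x \<in> _\<close> \<open>y \<in> _\<close> by (auto simp: c_def)
      with \<open>c x = c y\<close> show ?thesis by simp
    next
      assume "\<not> x \<le> m" "y \<le> m"
      then have "c y \<le> m" "c x > m"
        using le[of y] \<open>x \<in> _\<close> \<open>y \<in> _\<close> by (auto simp: c_def)
      with \<open>c x = c y\<close> show ?thesis by simp
    next
      assume "\<not> x \<le> m" "\<not> y \<le> m"
      with \<open>c x = c y\<close> \<open>x \<in> _\<close> \<open>y \<in> _\<close> show ?thesis
        by (simp add: c_def split: if_splits)
    qed
  qed
  have "c ` {1..m + k} \<subseteq> {1..m + k}"
  proof clarify
    fix x assume "x \<in> {1..m + k}"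
    then show "c x \<in> {1..m + k}"
      using le[of x] k by (cases "x \<le> m") (auto simp: c_def)
  qed
  then have "bij_betw c {1..m + k} {1..m + k}"
    using inj by (simp add: bij_betw_def endo_inj_surj)
  then have c: "c permutes {1..m + k}"
    using id k by (intro bij_imp_permutes) (auto simp: c_def permutes_not_in[OF \<omega>])
  have old: "orbit c x = orbit \<omega> x" if "x \<in> {1..m}" for x
    using that
  proof (rule orbit_cong0)
    show c_eq: "c y = \<omega> y" if "y \<in> {1..m}" for y
      using that k by (simp add: c_def)
    show "c \<in> {1..m} \<rightarrow> {1..m}"
      using c_eq permutes_in_image[OF \<omega>] by (intro funcsetI) (simp only:)
  qed
  have reach: "m + 1 + i \<in> orbit c (m + 1)" if "i < k" for i
    using that
  proof (induction i)
    case 0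
    show ?case using orbit_permutes_self[OF c] by simp
  next
    case (Suc i)
    then have "c (m + 1 + i) \<in> orbit c (m + 1)" by (intro orbit.step) simp
    moreover have "c (m + 1 + i) = m + 1 + Suc i" using Suc.prems by (simp add: c_def)
    ultimately show ?case by simp
  qed
  have "orbit c (m + 1) = {m + 1..m + k}"
  proof
    show "{m + 1..m + k} \<subseteq> orbit c (m + 1)"
    proof
      fix x assume "x \<in> {m + 1..m + k}"
      then show "x \<in> orbit c (m + 1)" using reach[of "x - (m + 1)"] by auto
    qed
    show "orbit c (m + 1) \<subseteq> {m + 1..m + k}"
    proof
      fix x assume "x \<in> orbit c (m + 1)"
      then show "x \<in> {m + 1..m + k}"
        by induction (use k in \<open>auto simp: c_def\<close>)
    qed
  qed
  moreover have "cyclic_on c (orbit c (m + 1))"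
    using c by (intro cyclic_on_orbit) auto
  ultimately have new: "orbit c x = {m + 1..m + k}" if "x \<in> {m + 1..m + k}" for x
    using that orbit_cyclic_eq3 by metis
  have "{1..m + k} = {1..m} \<union> {m + 1..m + k}" by auto
  then have "orbit c ` {1..m + k} = orbit c ` {1..m} \<union> orbit c ` {m + 1..m + k}"
    by (simp add: image_Un)
  also have "orbit c ` {1..m} = orbit \<omega> ` {1..m}"
    using old by (intro image_cong) auto
  also have "orbit c ` {m + 1..m + k} = {{m + 1..m + k}}"
    using new k by (auto simp: image_iff intro!: exI[of _ "m + 1"])
  finally have "orbit c ` {1..m + k} = insert {m + 1..m + k} (orbit \<omega> ` {1..m})" by simp
  \<comment> \<open>Freshness of the new block ensures that \<open>insert\<close> enlarges the set
    of supports, so the multiset gains exactly one part \<open>k\<close>.\<close>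
  moreover have "{m + 1..m + k} \<notin> orbit \<omega> ` {1..m}"
    using permutes_orbit_subset[OF \<omega>] k by fastforce
  ultimately have "cycle_type (m + k) c = add_mset k (cycle_type m \<omega>)"
    by (simp add: cycle_type_def)
  with c show thesis by (rule that)
qed

text \<open>\<open>pmf_of_set\<close> is the uniform distribution only on a nonempty finite set. A
  witness is built from the identity on the empty set by adding one cycle per part.\<close>

lemma conj_class_nonempty:
  assumes "partition_of n lam"
  shows "conj_class n lam \<noteq> {}"
  using assms
proof (induction lam arbitrary: n)
  case empty
  then have "n = 0" by (simp add: partition_of_def)
  then show ?case by (auto simp: conj_class_def cycle_type_def intro!: exI[of _ id])
next
  case (add k lam)
  then have "k > 0" "n = sum_mset lam + k" "partition_of (sum_mset lam) lam"
    by (auto simp: partition_of_def)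
  moreover from add.IH[OF this(3)] obtain \<omega> where
    "\<omega> permutes {1..sum_mset lam}" "cycle_type (sum_mset lam) \<omega> = lam"
    by (auto simp: conj_class_def)
  ultimately show ?case
    by (metis (mono_tags, lifting) conj_class_def cycle_type_append_cycle empty_iff mem_Collect_eq)
qed

section \<open>Expectation over a conjugacy class\<close>

text \<open>Double counting of \<open>X (\<sigma> \<circ> \<omega> \<circ> inv \<sigma>)\<close>
  over all \<open>\<sigma>\<close> and all \<open>\<omega>\<close> in the class: each
  \<open>\<sigma>\<close> contributes the class sum of \<open>X\<close>, and each
  \<open>\<omega>\<close> contributes the same value of \<open>K\<close>.\<close>

lemma class_expectation_pair_sum:
  fixes h :: "nat \<Rightarrow> nat \<Rightarrow> nat \<Rightarrow> nat \<Rightarrow> real"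
  assumes X: "\<And>\<omega>. X \<omega> = (\<Sum>(i, j) \<in> Sigma {1..n} (\<lambda>i. {1..n} - {i}). h i j (\<omega> i) (\<omega> j))"
  obtains K where "\<And>lam. partition_of n lam \<Longrightarrow> class_expectation n lam X = K (count lam 1) (count lam 2)"
proof -
  let ?S = "{1..n}"
  obtain K where K: "\<And>\<omega>. \<omega> permutes ?S \<Longrightarrow>
      (\<Sum>(p, q) \<in> Sigma ?S (\<lambda>p. ?S - {p}). symmetrized ?S h p q (\<omega> p) (\<omega> q)) =
      K (card {p \<in> ?S. \<omega> p = p}) (card {p \<in> ?S. \<omega> p \<noteq> p \<and> \<omega> (\<omega> p) = p})"
    using sum_symmetrized_fixpoints_2cycles[of ?S h] by auto
  show thesis
  proof (rule that)
    fix lam assume "partition_of n lam"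
    let ?C = "conj_class n lam"
    \<comment> \<open>The factor 2 appears because each 2-cycle contributes two points.\<close>
    let ?k = "K (count lam 1) (2 * count lam 2)"
    have ne: "?C \<noteq> {}" by (rule conj_class_nonempty) fact
    have fin: "finite ?C"
      by (rule finite_subset[OF _ finite_permutations[of ?S]]) (auto simp: conj_class_def)
    have avg: "(\<Sum>\<sigma> | \<sigma> permutes ?S. X (\<sigma> \<circ> \<omega> \<circ> inv \<sigma>)) = ?k" if "\<omega> \<in> ?C" for \<omega>
    proof -
      from that have \<omega>: "\<omega> permutes ?S" and ct: "cycle_type n \<omega> = lam"
        by (auto simp: conj_class_def)
      have "card {p \<in> ?S. \<omega> p = p} = count lam 1"
        using card_points_in_orbits_of_size[OF \<omega>, of 1] by (simp only: card_orbit_eq_1_iff[OF \<omega> finite_atLeastAtMost] ct)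
      moreover have "card {p \<in> ?S. \<omega> p \<noteq> p \<and> \<omega> (\<omega> p) = p} = 2 * count lam 2"
        using card_points_in_orbits_of_size[OF \<omega>, of 2] by (simp only: card_orbit_eq_2_iff[OF \<omega> finite_atLeastAtMost] ct)
      ultimately show ?thesis
        unfolding X using K[OF \<omega>] by (subst sum_conjugates_eq_sum_symmetrized) simp_all
    qed
    have "fact n * (\<Sum>\<omega>\<in>?C. X \<omega>) = (\<Sum>\<sigma> | \<sigma> permutes ?S. \<Sum>\<omega>\<in>?C. X (\<sigma> \<circ> \<omega> \<circ> inv \<sigma>))"
      using card_permutations[of ?S n] by (simp add: sum_conj_class_conjugate)
    also have "\<dots> = (\<Sum>\<omega>\<in>?C. \<Sum>\<sigma> | \<sigma> permutes ?S. X (\<sigma> \<circ> \<omega> \<circ> inv \<sigma>))"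
      by (rule sum.swap)
    also have "\<dots> = card ?C * ?k"
      using avg by simp
    \<comment> \<open>This fixes the function to be exhibited: it sends \<open>a\<close> and
      \<open>b\<close> to \<open>K a (2 * b) / fact n\<close>.\<close>
    finally show "class_expectation n lam X = ?k / fact n"
      using ne fin by (simp add: class_expectation_def integral_pmf_of_set field_simps)
  qed
qed

theorem theorem1p1:
  fixes n :: nat and wt :: "nat \<Rightarrow> nat \<Rightarrow> real" and lam mu :: "nat multiset"
  assumes "n \<ge> 1"
    and "partition_of n lam" and "partition_of n mu"
    and "count lam 1 = count mu 1" and "count lam 2 = count mu 2"
  shows "class_expectation n lam (weighted_inversion_stat n wt) =
         class_expectation n mu (weighted_inversion_stat n wt)"
proof -
  \<comment> \<open>Moving the condition \<open>i < j\<close> into \<open>h\<close> lets the sum run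
    over all ordered pairs \<open>i \<noteq> j\<close>, a domain stable under relabelling; the added
    pairs contribute 0.\<close>
  define h where "h i j r s = (if i < j \<and> s < r then wt i j else 0)" for i j r s :: nat
  have "weighted_inversion_stat n wt \<omega> =
      (\<Sum>(i, j) \<in> Sigma {1..n} (\<lambda>i. {1..n} - {i}). h i j (\<omega> i) (\<omega> j))" for \<omega>
    unfolding weighted_inversion_stat_def
    by (rule sum.mono_neutral_cong_left) (auto simp: h_def inversion_ind_def split: if_splits)
  then obtain K where "\<And>lam. partition_of n lam \<Longrightarrow>
      class_expectation n lam (weighted_inversion_stat n wt) = K (count lam 1) (count lam 2)"
    using class_expectation_pair_sum[where h = h and n = n and X = "weighted_inversion_stat n wt"]
    by blast
  with assms show ?thesis by simp
qed

end
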